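(* Let $\mathbf{M}$ be a nonempty ultrametric space, let $V=\mathrm{Spec}(\mathbf{M})$ and let $\mathbf{s}=\mathbf{s}_{\mathbf{M}}$. Then $\mathbf{M}$ is isometrically embeddable into $\mathbf{M}_{\mathbf{s}}(\mathrm{Well}(V))$.
   Context: A metric space $(M,d)$ is ultrametric if $d(x,z)\le\max\{d(x,y),d(y,z)\}$ for all $x,y,z$. A space is isometrically embeddable into another if there is a distance-preserving map from the first into the second. For an ultrametric space $\mathbf{M}=(M,d)$: $\mathrm{Spec}(\mathbf{M},a)=\{d(a,x):x\in M\}$ and $\mathrm{Spec}(\mathbf{M})=\{d(x,y):x,y\in M\}$; $\hat B(a,r)=\{x:d(a,x)\le r\}$ and $B(a,r)=\{x:d(a,x)<r\}$; $\mathrm{Nerv}(\mathbf{M})=\{\hat B(a,r): a\in M, r\in\mathrm{Spec}(\mathbf{M},a)\}$; $\delta(B)$ is the diameter of $B$. For $B\in\mathrm{Nerv}(\mathbf{M})$ with $r=\delta(B)>0$, a son of $B$ is any open ball of radius $r$ (centered at a point of $B$) contained in $B$, and $\mathbf{s}_{\mathbf{M}}(B)$ is the cardinality of the set of sons of $B$. For $r\in\mathrm{Spec}(\mathbf{M})\setminus\{0\}$, $\mathbf{s}_{\mathbf{M}}(r)$ is the supremum of the cardinals $\mathbf{s}_{\mathbf{M}}(B)$ over all $B\in\mathrm{Nerv}(\mathbf{M})$ of diameter $r$. Cardinals are identified with initial ordinals. Let $V$ be a set of non-negative reals containing $0$, $V_*=V\setminus\{0\}$, and $\mathbf{s}$ a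 function assigning to each $r\in V_*$ a cardinal $\mathbf{s}(r)\ge2$. For $f\in\prod_{r\in V_*}\mathbf{s}(r)$ the support is $\mathrm{supp}(f)=\{r\in V_*: f(r)\ne0\}$. $\mathrm{Well}(V)$ is the collection of subsets of $V_*$ that are dually well ordered (every nonempty subset has a largest element). $\mathbf{M}_{\mathbf{s}}(\mathrm{Well}(V))$ is the set of $f\in\prod_{r\in V_*}\mathbf{s}(r)$ with $\mathrm{supp}(f)\in\mathrm{Well}(V)$, with the distance $d(f,f)=0$ and $d(f,g)=\max\{r\in V_*: f(r)\ne g(r)\}$ for $f\ne g$. *)

theory Defs
  imports "HOL-Analysis.Analysis"
begin

unbundle cardinal_syntax

locale Ultrametric_space = Metric_space +
  assumes ultra: "\<And>x y z. \<lbrakk>x \<in> M; y \<in> M; z \<in> M\<rbrakk> \<Longrightarrow> d x z \<le> max (d x y) (d y z)"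

text \<open>The supremum of a set of cardinals, chosen among the cardinals on the same type. Every set of
  cardinals on \<open>'b\<close> is bounded by the cardinality of \<open>'b\<close>, and any cardinal below that
  bound has a copy on \<open>'b\<close>, so the restriction to one type loses nothing. Like every cardinal in
  the library, it is a well-order that is least among those on its field; it is determined up to
  order isomorphism and stands for the corresponding initial ordinal.\<close>

definition is_card_sup :: "'b rel set \<Rightarrow> 'b rel \<Rightarrow> bool" where
  "is_card_sup C k \<longleftrightarrow> Card_order k \<and> (\<forall>c\<in>C. c \<le>o k) \<and>
     (\<forall>k' :: 'b rel. Card_order k' \<and> (\<forall>c\<in>C. c \<le>o k') \<longrightarrow> k \<le>o k')"

definition card_sup :: "'b rel set \<Rightarrow> 'b rel" where
  "card_sup C = (SOME k. is_card_sup C k)"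

lemma is_card_sup_card_sup:
  fixes C :: "'b rel set"
  assumes "\<And>c. c \<in> C \<Longrightarrow> Card_order c"
  shows "is_card_sup C (card_sup C)"
proof -
  let ?R = "{k :: 'b rel. Card_order k \<and> (\<forall>c\<in>C. c \<le>o k)}"
  have "c \<le>o |UNIV :: 'b set|" if "c \<in> C" for c
    using card_of_Field_ordIso[OF assms[OF that]] card_of_mono1[OF subset_UNIV]
      ordIso_ordLeq_trans ordIso_symmetric by blast
  then have "|UNIV :: 'b set| \<in> ?R"
    by (simp add: card_of_Card_order)
  then obtain k where "k \<in> ?R" "\<forall>k'\<in>?R. k \<le>o k'"
    using exists_minim_Card_order[of ?R] by blast
  then have "is_card_sup C k"
    by (auto simp: is_card_sup_def)
  then show ?thesis
    unfolding card_sup_def by (rule someI)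
qed

lemma is_card_sup_unique:
  assumes "is_card_sup C k" "is_card_sup C k'"
  shows "(k, k') \<in> ordIso"
  using assms unfolding is_card_sup_def by (simp add: ordIso_iff_ordLeq)

context Metric_space
begin

definition Spec_at :: "'a \<Rightarrow> real set" where
  "Spec_at a = {d a x | x. x \<in> M}"

definition Spec :: "real set" where
  "Spec = {d x y | x y. x \<in> M \<and> y \<in> M}"

definition Nerv :: "'a set set" where
  "Nerv = {mcball a r | a r. a \<in> M \<and> r \<in> Spec_at a}"

definition mdiameter :: "'a set \<Rightarrow> real" where
  "mdiameter S = (if S = {} then 0 else SUP (x, y)\<in>S \<times> S. d x y)"

definition sons :: "'a set \<Rightarrow> 'a set set" where
  "sons B = {mball a (mdiameter B) | a. a \<in> B \<and> mball a (mdiameter B) \<subseteq> B}"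

definition sons_card :: "real \<Rightarrow> 'a set rel" where
  "sons_card r = card_sup {|sons B| | B. B \<in> Nerv \<and> mdiameter B = r}"

end

text \<open>A cardinal \<open>k\<close> is identified with the set of ordinals below it, that is, with
  \<open>Field k\<close> ordered by \<open>k\<close>; the ordinal \<open>0\<close> is the least element.\<close>

definition ord_zero :: "'b rel \<Rightarrow> 'b" where
  "ord_zero k = wo_rel.minim k (Field k)"

definition Well :: "real set \<Rightarrow> real set set" where
  "Well V = {W. W \<subseteq> V - {0} \<and> (\<forall>S. S \<subseteq> W \<and> S \<noteq> {} \<longrightarrow> (\<exists>m\<in>S. \<forall>x\<in>S. x \<le> m))}"

definition supp :: "real set \<Rightarrow> (real \<Rightarrow> 'b rel) \<Rightarrow> (real \<Rightarrow> 'b) \<Rightarrow> real set" where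
  "supp V s f = {r \<in> V - {0}. f r \<noteq> ord_zero (s r)}"

definition Mwell :: "real set \<Rightarrow> (real \<Rightarrow> 'b rel) \<Rightarrow> (real \<Rightarrow> 'b) set" where
  "Mwell V s = {f \<in> (\<Pi>\<^sub>E r\<in>V - {0}. Field (s r)). supp V s f \<in> Well V}"

definition Mwell_dist :: "real set \<Rightarrow> (real \<Rightarrow> 'b) \<Rightarrow> (real \<Rightarrow> 'b) \<Rightarrow> real" where
  "Mwell_dist V f g = (if f = g then 0 else (GREATEST r. r \<in> V - {0} \<and> f r \<noteq> g r))"

lemma Mwell_dist_attained:
  assumes f: "f \<in> Mwell V s" and g: "g \<in> Mwell V s" and "f \<noteq> g"
  shows "Mwell_dist V f g \<in> V - {0} \<and> f (Mwell_dist V f g) \<noteq> g (Mwell_dist V f g) \<and>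
    (\<forall>r\<in>V - {0}. f r \<noteq> g r \<longrightarrow> r \<le> Mwell_dist V f g)"
proof -
  let ?D = "{r \<in> V - {0}. f r \<noteq> g r}"
  have wf: "supp V s f \<in> Well V" and wg: "supp V s g \<in> Well V"
    and ext: "f \<in> extensional (V - {0})" "g \<in> extensional (V - {0})"
    using f g by (auto simp: Mwell_def PiE_def)
  have D: "?D \<subseteq> supp V s f \<union> supp V s g"
    by (auto simp: supp_def)
  have ne: "?D \<noteq> {}"
    using \<open>f \<noteq> g\<close> extensionalityI[OF ext] by blast
  have max: "\<exists>m\<in>S. \<forall>x\<in>S. x \<le> m" if "W \<in> Well V" "S \<subseteq> W" "S \<noteq> {}" for S W
    using that by (auto simp: Well_def)
  have "\<exists>m\<in>?D. \<forall>x\<in>?D. x \<le> m"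
  proof (cases "?D \<inter> supp V s f = {} \<or> ?D \<inter> supp V s g = {}")
    case True
    then have "?D \<subseteq> supp V s f \<or> ?D \<subseteq> supp V s g"
      using D by blast
    then show ?thesis
      using max[OF wf _ ne] max[OF wg _ ne] by blast
  next
    case False
    obtain m where m: "m \<in> ?D \<inter> supp V s f" "\<forall>x\<in>?D \<inter> supp V s f. x \<le> m"
      using max[OF wf, of "?D \<inter> supp V s f"] False by blast
    obtain n where n: "n \<in> ?D \<inter> supp V s g" "\<forall>x\<in>?D \<inter> supp V s g. x \<le> n"
      using max[OF wg, of "?D \<inter> supp V s g"] False by blast
    have "\<forall>x\<in>?D. x \<le> max m n"
      using D m(2) n(2) by (metis (no_types, lifting) IntI UnE max.coboundedI1 max.coboundedI2 subsetD)
    moreover have "max m n \<in> ?D"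
      using m(1) n(1) by (simp add: max_def)
    ultimately show ?thesis
      by blast
  qed
  then obtain m where m: "m \<in> ?D" "\<forall>x\<in>?D. x \<le> m"
    by blast
  then have "(GREATEST r. r \<in> V - {0} \<and> f r \<noteq> g r) = m"
    by (intro Greatest_equality) auto
  then show ?thesis
    using m \<open>f \<noteq> g\<close> by (auto simp: Mwell_dist_def)
qed

definition isometrically_embeddable ::
  "'a set \<Rightarrow> ('a \<Rightarrow> 'a \<Rightarrow> real) \<Rightarrow> 'b set \<Rightarrow> ('b \<Rightarrow> 'b \<Rightarrow> real) \<Rightarrow> bool" where
  "isometrically_embeddable M d M' d' \<longleftrightarrow>
     (\<exists>\<phi>. \<phi> \<in> M \<rightarrow> M' \<and> (\<forall>x\<in>M. \<forall>y\<in>M. d' (\<phi> x) (\<phi> y) = d x y))"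

end

(* Well-order the points, and inject the sons of every ball of diameter r into s(r) so that the son
   containing the least point of the ball goes to 0. Send x to the function whose value at r is the
   colour of the open ball B(x,r) as a son of the closed ball of radius r around x. If the value at r
   is not 0, then the least point of that closed ball lies at distance exactly r from x, so along the
   support of x the least points strictly decrease as r grows; hence the support is dually well
   ordered. *)

theory Submission
  imports Defs
begin

lemma Card_order_card_sup:
  fixes C :: "'b rel set"
  assumes "\<And>c. c \<in> C \<Longrightarrow> Card_order c"
  shows "Card_order (card_sup C)"
  using is_card_sup_card_sup[of C] assms by (simp add: is_card_sup_def)

lemma card_sup_upper:
  fixes C :: "'b rel set"
  assumes "\<And>c. c \<in> C \<Longrightarrow> Card_order c" and "c \<in> C"
  shows "c \<le>o card_sup C"
  using is_card_sup_card_sup[of C] assms by (simp add: is_card_sup_def)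

lemma ord_zero_in_Field:
  assumes "Card_order k" and "Field k \<noteq> {}"
  shows "ord_zero k \<in> Field k"
  using assms unfolding ord_zero_def
  by (simp add: card_order_on_well_order_on wo_rel.intro wo_rel.minim_in)

text \<open>Composing \<open>g\<close> with the transposition of \<open>z\<close> and
  \<open>g a\<close> keeps it injective and sends \<open>a\<close> to \<open>z\<close>. If
  \<open>a\<close> lies outside \<open>A\<close>, overwriting \<open>g\<close> at \<open>a\<close>
  changes nothing on \<open>A\<close>.\<close>

lemma inj_on_prescribed_value:
  assumes "inj_on g A" and "g ` A \<subseteq> F" and "z \<in> F"
  shows "\<exists>h. inj_on h A \<and> h ` A \<subseteq> F \<and> h a = z"
proof (cases "a \<in> A")
  case True
  define h where "h S = (if S = a then z else if g S = z then g a else g S)" for S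
  have "inj_on h A"
    using assms(1) True by (auto simp: h_def inj_on_def)
  moreover have "h ` A \<subseteq> F" "h a = z"
    using assms(2,3) True by (auto simp: h_def)
  ultimately show ?thesis by blast
next
  case False
  then have "inj_on (g(a := z)) A" "g(a := z) ` A \<subseteq> F"
    using assms(1,2) by (auto simp: inj_on_def)
  then show ?thesis by (metis fun_upd_same)
qed

lemma Mwell_dist_eqI:
  assumes "r \<in> V - {0}" and "f r \<noteq> g r" and "\<And>t. t \<in> V - {0} \<Longrightarrow> f t \<noteq> g t \<Longrightarrow> t \<le> r"
  shows "Mwell_dist V f g = r"
proof -
  have "(GREATEST r. r \<in> V - {0} \<and> f r \<noteq> g r) = r"
    using assms by (intro Greatest_equality) auto
  then show ?thesis
    using assms(2) by (auto simp: Mwell_dist_def)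
qed

context Metric_space
begin

lemma sons_card_Card_order: "Card_order (sons_card r)"
  unfolding sons_card_def
  by (rule Card_order_card_sup) (auto simp: card_of_Card_order)

lemma card_of_sons_le:
  assumes "B \<in> Nerv" and "mdiameter B = r"
  shows "|sons B| \<le>o sons_card r"
  unfolding sons_card_def using assms
  by (intro card_sup_upper) (auto simp: card_of_Card_order)

end

context Ultrametric_space
begin

lemma mcball_eq:
  assumes "x \<in> M" "y \<in> M" "d x y \<le> r"
  shows "mcball x r = mcball y r"
proof (intro set_eqI iffI)
  fix z assume "z \<in> mcball x r"
  then show "z \<in> mcball y r"
    using ultra[of y x z] assms commute[of x y] by (auto simp: mcball_def)
next
  fix z assume "z \<in> mcball y r"
  then show "z \<in> mcball x r"
    using ultra[of x y z] assms by (auto simp: mcball_def)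
qed

lemma mball_eq:
  assumes "x \<in> M" "y \<in> M" "d x y < r"
  shows "mball x r = mball y r"
proof (intro set_eqI iffI)
  fix z assume "z \<in> mball x r"
  then show "z \<in> mball y r"
    using ultra[of y x z] assms commute[of x y] by (auto simp: mball_def)
next
  fix z assume "z \<in> mball y r"
  then show "z \<in> mball x r"
    using ultra[of x y z] assms by (auto simp: mball_def)
qed

text \<open>The radius is attained by the pair \<open>x\<close>, \<open>y\<close>, and no distance
  in the ball exceeds it because every point of an ultrametric ball is a centre. Hence
  \<open>sons\<close> of such a ball are taken at its own radius.\<close>

lemma mdiameter_mcball:
  assumes "x \<in> M" "y \<in> M"
  shows "mdiameter (mcball x (d x y)) = d x y"
proof -
  let ?B = "mcball x (d x y)"
  have xy: "x \<in> ?B" "y \<in> ?B"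
    using assms by auto
  have "(SUP (u, v)\<in>?B \<times> ?B. d u v) = d x y"
  proof (rule cSup_eq_maximum)
    show "d x y \<in> (\<lambda>(u, v). d u v) ` (?B \<times> ?B)"
      using xy by force
  next
    fix t assume "t \<in> (\<lambda>(u, v). d u v) ` (?B \<times> ?B)"
    then obtain u v where uv: "u \<in> ?B" "v \<in> ?B" "t = d u v"
      by auto
    then have "v \<in> mcball u (d x y)"
      using mcball_eq[of x u "d x y"] assms by auto
    then show "t \<le> d x y"
      using uv by simp
  qed
  then show ?thesis
    using xy by (auto simp: mdiameter_def)
qed

lemma mcball_in_Nerv:
  assumes "x \<in> M" "y \<in> M"
  shows "mcball x (d x y) \<in> Nerv"
  using assms by (auto simp: Nerv_def Spec_at_def)

lemma mball_in_sons:
  assumes "x \<in> M" "y \<in> M"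
  shows "mball x (d x y) \<in> sons (mcball x (d x y))"
  using assms mdiameter_mcball[OF assms] mball_subset_mcball by (auto simp: sons_def)

text \<open>The number of sons is at most \<open>sons_card (d x y)\<close>, which gives an injection
  whose value at \<open>S\<close> can then be moved to zero. \<open>S\<close> is arbitrary, so it
  can later be the open ball around the least point with no check that this ball is a son.\<close>

lemma inj_on_sons_zero:
  assumes x: "x \<in> M" and y: "y \<in> M"
  shows "\<exists>h. inj_on h (sons (mcball x (d x y))) \<and>
    h ` sons (mcball x (d x y)) \<subseteq> Field (sons_card (d x y)) \<and> h S = ord_zero (sons_card (d x y))"
proof -
  let ?B = "mcball x (d x y)" and ?k = "sons_card (d x y)"
  have "|sons ?B| \<le>o ?k"
    by (rule card_of_sons_le[OF mcball_in_Nerv[OF x y] mdiameter_mcball[OF x y]])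
  then have "|sons ?B| \<le>o |Field ?k|"
    using card_of_Field_ordIso[OF sons_card_Card_order] ordIso_symmetric ordLeq_ordIso_trans
    by blast
  then obtain g where g: "inj_on g (sons ?B)" "g ` sons ?B \<subseteq> Field ?k"
    unfolding card_of_ordLeq[symmetric] by blast
  then have "Field ?k \<noteq> {}"
    using mball_in_sons[OF x y] by blast
  then show ?thesis
    by (intro inj_on_prescribed_value[OF g] ord_zero_in_Field sons_card_Card_order)
qed

lemma Field_sons_card_nonempty:
  assumes "r \<in> Spec"
  shows "Field (sons_card r) \<noteq> {}"
proof -
  obtain x y where xy: "x \<in> M" "y \<in> M" "r = d x y"
    using assms by (auto simp: Spec_def)
  then show ?thesis
    using inj_on_sons_zero[OF xy(1,2)] mball_in_sons[OF xy(1,2)] by blast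
qed

text \<open>The largest element of \<open>S\<close> is the radius \<open>m\<close> whose closed ball
  has the \<open>w\<close>-smallest least point. For a larger \<open>r\<close> in \<open>S\<close>,
  the least point of the bigger ball would have to be the same point, which already lies in
  \<open>mball x r\<close>.\<close>

lemma dually_well_ordered_least_points:
  assumes w: "well_order w" and x: "x \<in> M"
    and S: "S \<noteq> {}" "\<And>r. r \<in> S \<Longrightarrow> 0 < r \<and> wo_rel.minim w (mcball x r) \<notin> mball x r"
  shows "\<exists>m\<in>S. \<forall>r\<in>S. r \<le> m"
proof -
  interpret wo_rel w
    using well_order_on_Well_order[OF w] unfolding wo_rel_def by metis
  have F: "Field w = UNIV"
    using well_order_on_Well_order[OF w] by simp
  let ?p = "\<lambda>r. minim (mcball x r)"
  have p_in: "?p r \<in> mcball x r" if "r \<in> S" for r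
    using S(2)[OF that] x F by (intro minim_in) (auto simp: mcball_eq_empty)
  have "minim (?p ` S) \<in> ?p ` S"
    using S(1) F by (intro minim_in) auto
  then obtain m where m: "m \<in> S" "?p m = minim (?p ` S)"
    by auto
  have "r \<le> m" if r: "r \<in> S" for r
  proof (rule ccontr)
    assume "\<not> r \<le> m"
    then have less: "m < r" by simp
    have "(?p m, ?p r) \<in> w"
      using m r F by (auto intro: minim_least)
    moreover have "(?p r, ?p m) \<in> w"
      using p_in[OF m(1)] less F by (intro minim_least) auto
    ultimately have "?p r = ?p m"
      using ANTISYM by (auto dest: antisymD)
    then have "?p r \<in> mball x r"
      using p_in[OF m(1)] less by auto
    then show False
      using S(2)[OF r] by blast
  qed
  then show ?thesis
    using m(1) by blast
qed

theorem embeds_into_Mwell: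
  "isometrically_embeddable M d (Mwell Spec sons_card) (Mwell_dist Spec)"
proof -
  obtain w :: "'a rel" where w: "well_order w"
    using well_order_on by blast
  let ?p = "\<lambda>B. wo_rel.minim w B"
  \<comment> \<open>The choice depends only on the radius and the closed ball, so all points of that
    ball share one colouring of its sons.\<close>
  define h where "h r B = (SOME h. inj_on h (sons B) \<and> h ` sons B \<subseteq> Field (sons_card r) \<and>
      h (mball (?p B) r) = ord_zero (sons_card r))" for r B
  have h: "inj_on (h r B) (sons B) \<and> h r B ` sons B \<subseteq> Field (sons_card r) \<and>
      h r B (mball (?p B) r) = ord_zero (sons_card r)"
    if "x \<in> M" "y \<in> M" "r = d x y" "B = mcball x r" for x y r B
    unfolding h_def that(3,4) by (rule someI_ex[OF inj_on_sons_zero[OF that(1,2)]])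
  \<comment> \<open>If no point is at distance \<open>r\<close> from \<open>x\<close>, the open and
    closed balls coincide and the first branch gives zero. The second branch is therefore reached
    only at radii attained from \<open>x\<close>, where \<open>h\<close> has its properties.\<close>
  define \<phi> where "\<phi> x = (\<lambda>r\<in>Spec - {0}.
      if ?p (mcball x r) \<in> mball x r then ord_zero (sons_card r)
      else h r (mcball x r) (mball x r))" for x
  have pos: "0 < r" if "r \<in> Spec - {0}" for r
    using that nonneg by (auto simp: Spec_def less_le)
  have p_in: "?p (mcball x r) \<in> mcball x r" if "x \<in> M" "r \<in> Spec - {0}" for x r
    using pos[OF that(2)] that(1) well_order_on_Well_order[OF w]
    by (intro wo_rel.minim_in) (auto simp: wo_rel_def mcball_eq_empty)
  \<comment> \<open>At an attained radius the two branches agree: if the open ball contains the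
    least point, it is the open ball around that point, which \<open>h\<close> colours zero.\<close>
  have at_dist: "\<phi> x (d x y) = h (d x y) (mcball x (d x y)) (mball x (d x y))"
    if "x \<in> M" "y \<in> M" "x \<noteq> y" for x y
  proof -
    have "d x y \<in> Spec - {0}"
      using that by (auto simp: Spec_def)
    moreover have "h (d x y) (mcball x (d x y)) (mball x (d x y)) = ord_zero (sons_card (d x y))"
      if "?p (mcball x (d x y)) \<in> mball x (d x y)"
      using mball_eq[of x "?p (mcball x (d x y))" "d x y"] that h[OF \<open>x \<in> M\<close> \<open>y \<in> M\<close> refl refl]
        \<open>x \<in> M\<close> by auto
    ultimately show ?thesis
      by (simp add: \<phi>_def)
  qed
  have in_Mwell: "\<phi> x \<in> Mwell Spec sons_card" if x: "x \<in> M" for x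
  proof -
    have "\<phi> x r \<in> Field (sons_card r)" if r: "r \<in> Spec - {0}" for r
    proof (cases "?p (mcball x r) \<in> mball x r")
      case True
      then show ?thesis
        using r ord_zero_in_Field[OF sons_card_Card_order Field_sons_card_nonempty]
        by (simp add: \<phi>_def)
    next
      case False
      \<comment> \<open>The least point is in the closed ball but not in the open one, so it
        witnesses that \<open>r\<close> is a distance from \<open>x\<close>.\<close>
      define q where "q = ?p (mcball x r)"
      have q: "q \<in> M" "r = d x q"
        using p_in[OF x r] False by (auto simp: q_def)
      have "h r (mcball x r) (mball x r) \<in> Field (sons_card r)"
        using h[OF x q refl] mball_in_sons[OF x q(1)] q(2) by blast
      then show ?thesis
        using r False by (auto simp: \<phi>_def)
    qed
    moreover have "supp Spec sons_card (\<phi> x) \<in> Well Spec"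
    proof -
      have "0 < r \<and> ?p (mcball x r) \<notin> mball x r" if "r \<in> supp Spec sons_card (\<phi> x)" for r
        using that pos by (auto simp: supp_def \<phi>_def split: if_splits)
      then have "\<exists>m\<in>S. \<forall>r\<in>S. r \<le> m" if "S \<subseteq> supp Spec sons_card (\<phi> x)" "S \<noteq> {}" for S
        using that by (intro dually_well_ordered_least_points[OF w x]) auto
      then show ?thesis
        by (auto simp: Well_def supp_def)
    qed
    ultimately show ?thesis
      by (auto simp: Mwell_def \<phi>_def)
  qed
  have "Mwell_dist Spec (\<phi> x) (\<phi> y) = d x y" if x: "x \<in> M" and y: "y \<in> M" for x y
  proof (cases "x = y")
    case True
    then show ?thesis
      using x by (simp add: Mwell_dist_def)
  next
    case False
    let ?r = "d x y"
    show ?thesis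
    proof (rule Mwell_dist_eqI)
      show "?r \<in> Spec - {0}"
        using x y False by (auto simp: Spec_def)
      have B: "mcball x ?r = mcball y ?r"
        using mcball_eq[OF x y] by simp
      \<comment> \<open>The point \<open>y\<close> is at distance exactly \<open>?r\<close> from
        \<open>x\<close>, so it separates the two balls; they are distinct sons of one closed ball
        and get distinct colours.\<close>
      have "mball x ?r \<noteq> mball y ?r"
        using x y False by (metis in_mball less_irrefl mdist_pos_less zero)
      moreover have "mball x ?r \<in> sons (mcball x ?r)" "mball y ?r \<in> sons (mcball x ?r)"
        using mball_in_sons[OF x y] mball_in_sons[OF y x] B by (simp_all add: commute[of y x])
      moreover have "inj_on (h ?r (mcball x ?r)) (sons (mcball x ?r))"
        using h[OF x y refl refl] by blast
      ultimately have "h ?r (mcball x ?r) (mball x ?r) \<noteq> h ?r (mcball y ?r) (mball y ?r)"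
        unfolding B[symmetric] by (metis inj_onD)
      then show "\<phi> x ?r \<noteq> \<phi> y ?r"
        using at_dist[OF x y False] at_dist[OF y x] False by (simp add: commute[of y x])
    next
      fix t assume t: "t \<in> Spec - {0}" "\<phi> x t \<noteq> \<phi> y t"
      show "t \<le> ?r"
      proof (rule ccontr)
        assume "\<not> t \<le> ?r"
        \<comment> \<open>Beyond \<open>d x y\<close> both points have the same balls, and the value
          at \<open>t\<close> is computed from these balls alone.\<close>
        then have B: "mcball x t = mcball y t" "mball x t = mball y t"
          using mcball_eq[OF x y] mball_eq[OF x y] by auto
        show False
          using t(2) unfolding \<phi>_def restrict_def B by blast
      qed
    qed
  qed
  then show ?thesis
    using in_Mwell by (auto simp: isometrically_embeddable_def)
qed

end

theorem theorem4:
  fixes M :: "'a set" and d :: "'a \<Rightarrow> 'a \<Rightarrow> real"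
    and V :: "real set" and s :: "real \<Rightarrow> 'a set rel"
  assumes "Ultrametric_space M d"
    and "M \<noteq> {}"
    and "V = Metric_space.Spec M d"
    and "s = Metric_space.sons_card M d"
  shows "isometrically_embeddable M d (Mwell V s) (Mwell_dist V)"
  using Ultrametric_space.embeds_into_Mwell[OF assms(1)] assms(3,4) by simp

end
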